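(* Let $(\mathfrak g,\varphi,\xi,\eta)$ be a $3$-dimensional almost contact Lie algebra with abelian structure. Then $\mathfrak g$ is isomorphic to one of $$\mathbb R^3,\quad\mathfrak h_1^{\mathbb R},\quad\mathfrak{aff}(\mathbb R)\times\mathbb R,\quad\mathfrak{so}(3),\quad\mathfrak{sl}(2,\mathbb R),\quad\mathfrak r_{3,1},\quad\mathfrak r'_{3,\lambda},$$ with $\lambda\ge0$.
   Context: An almost contact Lie algebra is a real Lie algebra $\mathfrak g$ with $(\varphi,\xi,\eta)$, $\varphi\in\mathrm{End}(\mathfrak g)$, $\xi\in\mathfrak g$, $\eta\in\mathfrak g^*$, such that $\varphi^2=-I+\eta\otimes\xi$ and $\eta(\xi)=1$. The structure is abelian if $\mathrm{ad}_\xi\circ\varphi=\varphi\circ\mathrm{ad}_\xi$ and $[\varphi X,\varphi Y]=[X,Y]$ for all $X,Y\in\operatorname{Ker}\eta$. $\mathfrak h_1^{\mathbb R}$ is the $3$-dimensional real Heisenberg Lie algebra; $\mathfrak{aff}(\mathbb R)$ is the non-abelian $2$-dimensional real Lie algebra; $\mathfrak r_{3,1}$ is the Lie algebra with basis $e_1,e_2,e_3$ and non-zero brackets $[e_1,e_2]=e_2$, $[e_1,e_3]=e_3$; $\mathfrak r'_{3,\lambda}$ is the Lie algebra with basis $e_1,e_2,e_3$ and non-zero brackets $[e_1,e_2]=\lambda e_2-e_3$, $[e_1,e_3]=e_2+\lambda e_3$. *)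

theory Defs
  imports "HOL-Analysis.Analysis"
begin

section \<open>Real Lie algebras\<close>

text \<open>
  A Lie algebra lives on a subspace of a real vector space, so that matrix Lie algebras
  such as \<open>so(3)\<close> are covered directly. All maps are only constrained on the carrier.
\<close>

record 'a lie_struct =
  lcarrier :: "'a set"
  lbracket :: "'a \<Rightarrow> 'a \<Rightarrow> 'a"

definition linear_between ::
  "'a::real_vector set \<Rightarrow> 'b::real_vector set \<Rightarrow> ('a \<Rightarrow> 'b) \<Rightarrow> bool" where
  "linear_between V W f \<longleftrightarrow>
     f ` V \<subseteq> W \<and>
     (\<forall>x\<in>V. \<forall>y\<in>V. f (x + y) = f x + f y) \<and>
     (\<forall>c. \<forall>x\<in>V. f (c *\<^sub>R x) = c *\<^sub>R f x)"

locale real_lie_algebra =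
  fixes L :: "'a::real_vector lie_struct"
  assumes subspace_carrier: "subspace (lcarrier L)"
    and linear_right: "x \<in> lcarrier L \<Longrightarrow>
      linear_between (lcarrier L) (lcarrier L) (\<lambda>y. lbracket L x y)"
    and linear_left: "y \<in> lcarrier L \<Longrightarrow>
      linear_between (lcarrier L) (lcarrier L) (\<lambda>x. lbracket L x y)"
    and alternating: "x \<in> lcarrier L \<Longrightarrow> lbracket L x x = 0"
    and jacobi: "\<lbrakk>x \<in> lcarrier L; y \<in> lcarrier L; z \<in> lcarrier L\<rbrakk> \<Longrightarrow>
      lbracket L x (lbracket L y z) + lbracket L y (lbracket L z x)
        + lbracket L z (lbracket L x y) = 0"

definition lie_isomorphic ::
  "'a::real_vector lie_struct \<Rightarrow> 'b::real_vector lie_struct \<Rightarrow> bool" where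
  "lie_isomorphic L M \<longleftrightarrow>
     (\<exists>f. linear_between (lcarrier L) (lcarrier M) f \<and>
          bij_betw f (lcarrier L) (lcarrier M) \<and>
          (\<forall>x\<in>lcarrier L. \<forall>y\<in>lcarrier L.
             f (lbracket L x y) = lbracket M (f x) (f y)))"

definition lie_product ::
  "'a::real_vector lie_struct \<Rightarrow> 'b::real_vector lie_struct \<Rightarrow> ('a \<times> 'b) lie_struct" where
  "lie_product L M =
     \<lparr>lcarrier = lcarrier L \<times> lcarrier M,
      lbracket = (\<lambda>x y. (lbracket L (fst x) (fst y), lbracket M (snd x) (snd y)))\<rparr>"

section \<open>Almost contact Lie algebras\<close>

locale almost_contact_lie_algebra = real_lie_algebra L
  for L :: "'a::real_vector lie_struct" +
  fixes \<phi> :: "'a \<Rightarrow> 'a" and \<xi> :: 'a and \<eta> :: "'a \<Rightarrow> real"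
  assumes phi_linear: "linear_between (lcarrier L) (lcarrier L) \<phi>"
    and xi_carrier: "\<xi> \<in> lcarrier L"
    and eta_linear: "linear_between (lcarrier L) UNIV \<eta>"
    and phi_phi: "x \<in> lcarrier L \<Longrightarrow> \<phi> (\<phi> x) = - x + \<eta> x *\<^sub>R \<xi>"
    and eta_xi: "\<eta> \<xi> = 1"

locale abelian_almost_contact_lie_algebra = almost_contact_lie_algebra L \<phi> \<xi> \<eta>
  for L :: "'a::real_vector lie_struct" and \<phi> \<xi> \<eta> +
  assumes ad_xi_phi: "x \<in> lcarrier L \<Longrightarrow> lbracket L \<xi> (\<phi> x) = \<phi> (lbracket L \<xi> x)"
    and bracket_phi_phi: "\<lbrakk>x \<in> lcarrier L; \<eta> x = 0; y \<in> lcarrier L; \<eta> y = 0\<rbrakk> \<Longrightarrow>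
      lbracket L (\<phi> x) (\<phi> y) = lbracket L x y"

section \<open>The Lie algebras of the classification\<close>

definition abelian_lie :: "'a::real_vector lie_struct" where
  "abelian_lie = \<lparr>lcarrier = UNIV, lbracket = (\<lambda>x y. 0)\<rparr>"

text \<open>
  The alternating bilinear bracket on \<open>\<real>\<^sup>3\<close> determined on the standard basis by
  \<open>[e\<^sub>1,e\<^sub>2] = u\<close>, \<open>[e\<^sub>1,e\<^sub>3] = v\<close>, \<open>[e\<^sub>2,e\<^sub>3] = w\<close>.
  The Jacobi identity depends on the choice of \<open>u\<close>, \<open>v\<close>, \<open>w\<close>.
\<close>

definition lie3 :: "real^3 \<Rightarrow> real^3 \<Rightarrow> real^3 \<Rightarrow> (real^3) lie_struct" where
  "lie3 u v w =
     \<lparr>lcarrier = UNIV,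
      lbracket = (\<lambda>x y. (x$1 * y$2 - x$2 * y$1) *\<^sub>R u
                      + (x$1 * y$3 - x$3 * y$1) *\<^sub>R v
                      + (x$2 * y$3 - x$3 * y$2) *\<^sub>R w)\<rparr>"

definition heisenberg_lie :: "(real^3) lie_struct" where
  "heisenberg_lie = lie3 (axis 3 1) 0 0"

definition r31_lie :: "(real^3) lie_struct" where
  "r31_lie = lie3 (axis 2 1) (axis 3 1) 0"

definition r3'_lie :: "real \<Rightarrow> (real^3) lie_struct" where
  "r3'_lie l = lie3 (l *\<^sub>R axis 2 1 - axis 3 1) (axis 2 1 + l *\<^sub>R axis 3 1) 0"

text \<open>The non-abelian two-dimensional Lie algebra, normalised to \<open>[e\<^sub>1,e\<^sub>2] = e\<^sub>2\<close>.\<close>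

definition aff_lie :: "(real^2) lie_struct" where
  "aff_lie =
     \<lparr>lcarrier = UNIV,
      lbracket = (\<lambda>x y. (x$1 * y$2 - x$2 * y$1) *\<^sub>R axis 2 1)\<rparr>"

definition matrix_commutator :: "real^'n^'n \<Rightarrow> real^'n^'n \<Rightarrow> real^'n^'n" where
  "matrix_commutator A B = A ** B - B ** A"

definition so3_lie :: "(real^3^3) lie_struct" where
  "so3_lie = \<lparr>lcarrier = {A. transpose A = - A}, lbracket = matrix_commutator\<rparr>"

definition sl2_lie :: "(real^2^2) lie_struct" where
  "sl2_lie = \<lparr>lcarrier = {A. trace A = 0}, lbracket = matrix_commutator\<rparr>"

subsection \<open>The models are Lie algebras\<close>

lemma real_lie_algebra_abelian: "real_lie_algebra abelian_lie"
  by unfold_locales (auto simp: abelian_lie_def linear_between_def)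

lemma real_lie_algebra_product:
  assumes "real_lie_algebra L" "real_lie_algebra M"
  shows "real_lie_algebra (lie_product L M)"
proof -
  interpret L: real_lie_algebra L by fact
  interpret M: real_lie_algebra M by fact
  show ?thesis
  proof
    show "subspace (lcarrier (lie_product L M))"
      by (simp add: lie_product_def subspace_Times L.subspace_carrier M.subspace_carrier)
  next
    fix x assume "x \<in> lcarrier (lie_product L M)"
    then have "fst x \<in> lcarrier L" "snd x \<in> lcarrier M"
      by (auto simp: lie_product_def)
    then show
      "linear_between (lcarrier (lie_product L M)) (lcarrier (lie_product L M))
         (\<lambda>y. lbracket (lie_product L M) x y)"
      "linear_between (lcarrier (lie_product L M)) (lcarrier (lie_product L M))
         (\<lambda>y. lbracket (lie_product L M) y x)"
      "lbracket (lie_product L M) x x = 0"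
      using L.linear_right[of "fst x"] M.linear_right[of "snd x"]
        L.linear_left[of "fst x"] M.linear_left[of "snd x"]
        L.alternating[of "fst x"] M.alternating[of "snd x"]
      by (simp_all add: lie_product_def linear_between_def image_subset_iff zero_prod_def)
  next
    fix x y z
    assume "x \<in> lcarrier (lie_product L M)" "y \<in> lcarrier (lie_product L M)"
      "z \<in> lcarrier (lie_product L M)"
    then show "lbracket (lie_product L M) x (lbracket (lie_product L M) y z)
        + lbracket (lie_product L M) y (lbracket (lie_product L M) z x)
        + lbracket (lie_product L M) z (lbracket (lie_product L M) x y) = 0"
      using L.jacobi[of "fst x" "fst y" "fst z"] M.jacobi[of "snd x" "snd y" "snd z"]
      by (auto simp: lie_product_def zero_prod_def)
  qed
qed

lemma real_lie_algebra_lie3: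
  assumes "\<And>x y z. lbracket (lie3 u v w) x (lbracket (lie3 u v w) y z)
    + lbracket (lie3 u v w) y (lbracket (lie3 u v w) z x)
    + lbracket (lie3 u v w) z (lbracket (lie3 u v w) x y) = 0"
  shows "real_lie_algebra (lie3 u v w)"
proof
  show "subspace (lcarrier (lie3 u v w))"
    by (simp add: lie3_def)
  show "linear_between (lcarrier (lie3 u v w)) (lcarrier (lie3 u v w))
    (\<lambda>y. lbracket (lie3 u v w) x y)" for x
    by (simp add: lie3_def linear_between_def algebra_simps)
  show "linear_between (lcarrier (lie3 u v w)) (lcarrier (lie3 u v w))
    (\<lambda>x. lbracket (lie3 u v w) x y)" for y
    by (simp add: lie3_def linear_between_def algebra_simps)
  show "lbracket (lie3 u v w) x x = 0" for x
    by (simp add: lie3_def)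
qed (rule assms)

lemma real_lie_algebra_heisenberg: "real_lie_algebra heisenberg_lie"
  unfolding heisenberg_lie_def
  by (rule real_lie_algebra_lie3) (simp add: lie3_def vec_eq_iff forall_3 axis_def)

lemma real_lie_algebra_r31: "real_lie_algebra r31_lie"
  unfolding r31_lie_def
  by (rule real_lie_algebra_lie3)
    (simp add: lie3_def vec_eq_iff forall_3 axis_def, simp add: algebra_simps)

lemma real_lie_algebra_r3': "real_lie_algebra (r3'_lie l)"
  unfolding r3'_lie_def
  by (rule real_lie_algebra_lie3)
    (simp add: lie3_def vec_eq_iff forall_3 axis_def, simp add: algebra_simps)

lemma real_lie_algebra_aff: "real_lie_algebra aff_lie"
  by unfold_locales
    (auto simp: aff_lie_def linear_between_def vec_eq_iff forall_2 axis_def algebra_simps)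

lemma real_lie_algebra_matrix_commutator:
  fixes S :: "(real^'n^'n) set"
  assumes "subspace S"
    and "\<And>A B. A \<in> S \<Longrightarrow> B \<in> S \<Longrightarrow> matrix_commutator A B \<in> S"
  shows "real_lie_algebra \<lparr>lcarrier = S, lbracket = matrix_commutator\<rparr>"
proof
  have add: "A ** (B + C) = A ** B + A ** C" "(B + C) ** A = B ** A + C ** A"
    for A B C :: "real^'n^'n"
    by (simp_all add: matrix_matrix_mult_def vec_eq_iff algebra_simps sum.distrib)
  have diff: "A ** (B - C) = A ** B - A ** C" "(B - C) ** A = B ** A - C ** A"
    for A B C :: "real^'n^'n"
    by (simp_all add: matrix_matrix_mult_def vec_eq_iff algebra_simps sum_subtractf)
  have scaleR: "A ** (c *\<^sub>R B) = c *\<^sub>R (A ** B)" "(c *\<^sub>R B) ** A = c *\<^sub>R (B ** A)"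
    for A B :: "real^'n^'n" and c
    by (simp_all add: matrix_matrix_mult_def vec_eq_iff sum_distrib_left mult_ac)
  let ?L = "\<lparr>lcarrier = S, lbracket = matrix_commutator\<rparr>"
  show "subspace (lcarrier ?L)"
    using assms(1) by simp
  show "linear_between (lcarrier ?L) (lcarrier ?L) (\<lambda>y. lbracket ?L x y)"
    if "x \<in> lcarrier ?L" for x
    using that assms(2)
    by (auto simp: linear_between_def matrix_commutator_def add scaleR
        scaleR_right_diff_distrib)
  show "linear_between (lcarrier ?L) (lcarrier ?L) (\<lambda>x. lbracket ?L x y)"
    if "y \<in> lcarrier ?L" for y
    using that assms(2)
    by (auto simp: linear_between_def matrix_commutator_def add scaleR
        scaleR_right_diff_distrib)
  show "lbracket ?L x x = 0" for x
    by (simp add: matrix_commutator_def)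
  show "lbracket ?L x (lbracket ?L y z) + lbracket ?L y (lbracket ?L z x)
      + lbracket ?L z (lbracket ?L x y) = 0" for x y z
    by (simp add: matrix_commutator_def diff matrix_mul_assoc)
qed

lemma real_lie_algebra_so3: "real_lie_algebra so3_lie"
  unfolding so3_lie_def
proof (rule real_lie_algebra_matrix_commutator)
  have "transpose (A + B) = transpose A + transpose B"
    "transpose (c *\<^sub>R A) = c *\<^sub>R transpose A"
    "transpose (0 :: real^3^3) = 0" for A B :: "real^3^3" and c
    by (simp_all add: transpose_def vec_eq_iff)
  then show "subspace {A :: real^3^3. transpose A = - A}"
    by (simp add: subspace_def)
next
  have uminus: "(- A) ** (- B) = A ** B" for A B :: "real^3^3"
    by (simp add: matrix_matrix_mult_def vec_eq_iff)
  have "transpose (A - B) = transpose A - transpose B" for A B :: "real^3^3"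
    by (simp add: transpose_def vec_eq_iff)
  then show "matrix_commutator A B \<in> {A. transpose A = - A}"
    if "A \<in> {A. transpose A = - A}" "B \<in> {A. transpose A = - A}" for A B :: "real^3^3"
    using that by (simp add: matrix_commutator_def matrix_transpose_mul uminus)
qed

lemma real_lie_algebra_sl2: "real_lie_algebra sl2_lie"
  unfolding sl2_lie_def
proof (rule real_lie_algebra_matrix_commutator)
  show "subspace {A :: real^2^2. trace A = 0}"
    by (simp add: subspace_def trace_def sum.distrib flip: sum_distrib_left)
next
  show "matrix_commutator A B \<in> {A. trace A = 0}" for A B :: "real^2^2"
    using trace_mul_sym[of A B] by (simp add: matrix_commutator_def trace_sub)
qed

end

theory Submission
  imports Defs
begin

text \<open>
  Pick \<open>e \<noteq> 0\<close> in the kernel of \<open>\<eta>\<close> and put \<open>f = \<phi> e\<close>. Since \<open>ad \<xi>\<close> commutes with \<open>\<phi>\<close>, it acts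
  on this kernel as multiplication by the complex number \<open>a + b i\<close>. With
  \<open>[e,f] = p \<xi> + q e + r f\<close>, the Jacobi identity becomes \<open>a p = 0\<close> and
  \<open>(a - b i) (q + r i) = 0\<close>. In each of the resulting cases one of the models has a basis
  with these structure constants.
\<close>

section \<open>Lie algebras with equal structure constants\<close>

text \<open>Coordinates along an ordered triple rather than the span of a set, so that no separate
  distinctness of the three vectors has to be carried along.\<close>

definition lie_basis :: "'a::real_vector lie_struct \<Rightarrow> 'a \<Rightarrow> 'a \<Rightarrow> 'a \<Rightarrow> bool" where
  "lie_basis L x y z \<longleftrightarrow>
     x \<in> lcarrier L \<and> y \<in> lcarrier L \<and> z \<in> lcarrier L \<and>
     (\<forall>v\<in>lcarrier L. \<exists>a b c. v = a *\<^sub>R x + b *\<^sub>R y + c *\<^sub>R z) \<and>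
     (\<forall>a b c. a *\<^sub>R x + b *\<^sub>R y + c *\<^sub>R z = 0 \<longrightarrow> a = 0 \<and> b = 0 \<and> c = 0)"

lemma lie_basis_coord_eq:
  assumes "lie_basis L x y z"
    and "a *\<^sub>R x + b *\<^sub>R y + c *\<^sub>R z = a' *\<^sub>R x + b' *\<^sub>R y + c' *\<^sub>R z"
  shows "a = a' \<and> b = b' \<and> c = c'"
proof -
  have "(a - a') *\<^sub>R x + (b - b') *\<^sub>R y + (c - c') *\<^sub>R z = 0"
    using assms(2) by (simp add: algebra_simps)
  then have "a - a' = 0 \<and> b - b' = 0 \<and> c - c' = 0"
    using assms(1) unfolding lie_basis_def by blast
  then show ?thesis by simp
qed

context real_lie_algebra
begin

lemma carrier_add [simp]: "x \<in> lcarrier L \<Longrightarrow> y \<in> lcarrier L \<Longrightarrow> x + y \<in> lcarrier L"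
  and carrier_scaleR [simp]: "x \<in> lcarrier L \<Longrightarrow> c *\<^sub>R x \<in> lcarrier L"
  using subspace_carrier by (auto simp: subspace_add subspace_scale)

lemma bracket_carrier [simp]:
  "x \<in> lcarrier L \<Longrightarrow> y \<in> lcarrier L \<Longrightarrow> lbracket L x y \<in> lcarrier L"
  using linear_right[of x] by (auto simp: linear_between_def)

lemma bracket_add_right [simp]:
  "\<lbrakk>x \<in> lcarrier L; y \<in> lcarrier L; z \<in> lcarrier L\<rbrakk> \<Longrightarrow>
     lbracket L x (y + z) = lbracket L x y + lbracket L x z"
  and bracket_add_left [simp]:
  "\<lbrakk>x \<in> lcarrier L; y \<in> lcarrier L; z \<in> lcarrier L\<rbrakk> \<Longrightarrow>
     lbracket L (y + z) x = lbracket L y x + lbracket L z x"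
  and bracket_scaleR_right [simp]:
  "\<lbrakk>x \<in> lcarrier L; y \<in> lcarrier L\<rbrakk> \<Longrightarrow> lbracket L x (c *\<^sub>R y) = c *\<^sub>R lbracket L x y"
  and bracket_scaleR_left [simp]:
  "\<lbrakk>x \<in> lcarrier L; y \<in> lcarrier L\<rbrakk> \<Longrightarrow> lbracket L (c *\<^sub>R y) x = c *\<^sub>R lbracket L y x"
  using linear_right[of x] linear_left[of x] by (simp_all add: linear_between_def)

lemma bracket_swap:
  assumes "x \<in> lcarrier L" "y \<in> lcarrier L"
  shows "lbracket L y x = - lbracket L x y"
  using assms alternating[of "x + y"] alternating[of x] alternating[of y]
  by (simp add: eq_neg_iff_add_eq_0 add.commute)

text \<open>Alternation collapses the nine terms of the bilinear expansion to three, weighted by the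
  2x2 minors of the two coordinate triples.\<close>

lemma bracket_basis:
  assumes "x \<in> lcarrier L" "y \<in> lcarrier L" "z \<in> lcarrier L"
  shows "lbracket L (a *\<^sub>R x + b *\<^sub>R y + c *\<^sub>R z) (a' *\<^sub>R x + b' *\<^sub>R y + c' *\<^sub>R z) =
    (a * b' - b * a') *\<^sub>R lbracket L x y + (a * c' - c * a') *\<^sub>R lbracket L x z
      + (b * c' - c * b') *\<^sub>R lbracket L y z"
  using assms by (simp add: alternating bracket_swap[of x y] bracket_swap[of x z]
      bracket_swap[of y z] algebra_simps)

end

text \<open>The isomorphism carries each vector to the one with the same coordinates in the other
  basis. By \<open>bracket_basis\<close> the coordinates of a bracket depend only on those of its
  arguments and on the structure constants.\<close>

lemma lie_isomorphic_if_same_constants: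
  assumes "real_lie_algebra L" "real_lie_algebra M"
    and basL: "lie_basis L x y z" and basM: "lie_basis M x' y' z'"
    and xyL: "lbracket L x y = u1 *\<^sub>R x + u2 *\<^sub>R y + u3 *\<^sub>R z"
    and xzL: "lbracket L x z = v1 *\<^sub>R x + v2 *\<^sub>R y + v3 *\<^sub>R z"
    and yzL: "lbracket L y z = w1 *\<^sub>R x + w2 *\<^sub>R y + w3 *\<^sub>R z"
    and xyM: "lbracket M x' y' = u1 *\<^sub>R x' + u2 *\<^sub>R y' + u3 *\<^sub>R z'"
    and xzM: "lbracket M x' z' = v1 *\<^sub>R x' + v2 *\<^sub>R y' + v3 *\<^sub>R z'"
    and yzM: "lbracket M y' z' = w1 *\<^sub>R x' + w2 *\<^sub>R y' + w3 *\<^sub>R z'"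
  shows "lie_isomorphic L M"
proof -
  interpret L: real_lie_algebra L by fact
  interpret M: real_lie_algebra M by fact
  have cL: "x \<in> lcarrier L" "y \<in> lcarrier L" "z \<in> lcarrier L"
    and cM: "x' \<in> lcarrier M" "y' \<in> lcarrier M" "z' \<in> lcarrier M"
    using basL basM by (auto simp: lie_basis_def)
  define g where "g = (\<lambda>(a, b, c). a *\<^sub>R x + b *\<^sub>R y + c *\<^sub>R z)"
  define g' where "g' = (\<lambda>(a, b, c). a *\<^sub>R x' + b *\<^sub>R y' + c *\<^sub>R z')"
  have g: "bij_betw g UNIV (lcarrier L)"
    unfolding bij_betw_def
  proof
    show "inj g"
      using lie_basis_coord_eq[OF basL] by (auto simp: inj_on_def g_def)
    show "range g = lcarrier L"
      using cL basL L.carrier_add L.carrier_scaleR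
      by (fastforce simp: lie_basis_def g_def image_iff)
  qed
  have g': "bij_betw g' UNIV (lcarrier M)"
    unfolding bij_betw_def
  proof
    show "inj g'"
      using lie_basis_coord_eq[OF basM] by (auto simp: inj_on_def g'_def)
    show "range g' = lcarrier M"
      using cM basM M.carrier_add M.carrier_scaleR
      by (fastforce simp: lie_basis_def g'_def image_iff)
  qed
  define f where "f = g' \<circ> inv g"
  have fg: "f (g t) = g' t" for t
    using g by (simp add: f_def bij_betw_def)
  have ex: "\<exists>a b c. v = g (a, b, c)" if "v \<in> lcarrier L" for v
    using that basL by (auto simp: g_def lie_basis_def)
  have lin: "g t + g t' = g (t + t')" "g' t + g' t' = g' (t + t')"
    "c *\<^sub>R g t = g (c *\<^sub>R t)" "c *\<^sub>R g' t = g' (c *\<^sub>R t)" for t t' c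
    by (auto simp: g_def g'_def algebra_simps split: prod.splits)
  have "bij_betw f (lcarrier L) (lcarrier M)"
    unfolding f_def using g g' bij_betw_inv_into bij_betw_trans by blast
  moreover have "linear_between (lcarrier L) (lcarrier M) f"
    unfolding linear_between_def
  proof (intro conjI ballI allI)
    show "f ` lcarrier L \<subseteq> lcarrier M"
      using calculation by (simp add: bij_betw_def)
    show "f (v + w) = f v + f w" if "v \<in> lcarrier L" "w \<in> lcarrier L" for v w
      using ex[OF that(1)] ex[OF that(2)] by (auto simp: lin fg simp del: add_Pair)
    show "f (c *\<^sub>R v) = c *\<^sub>R f v" if "v \<in> lcarrier L" for c v
      using ex[OF that] by (auto simp: lin fg simp del: scaleR_Pair)
  qed
  moreover have "f (lbracket L v w) = lbracket M (f v) (f w)"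
    if vL: "v \<in> lcarrier L" and wL: "w \<in> lcarrier L" for v w
  proof -
    obtain a b c where v: "v = g (a, b, c)" using ex[OF vL] by blast
    obtain a' b' c' where w: "w = g (a', b', c')" using ex[OF wL] by blast
    \<comment> \<open>\<open>t\<close> is the coordinate triple of the bracket, the same in both
      algebras.\<close>
    define t where "t = (a * b' - b * a') *\<^sub>R (u1, u2, u3) + (a * c' - c * a') *\<^sub>R (v1, v2, v3)
      + (b * c' - c * b') *\<^sub>R (w1, w2, w3)"
    have "lbracket L v w = g t"
      by (simp only: v w t_def g_def prod.case L.bracket_basis[OF cL] xyL xzL yzL
          scaleR_Pair add_Pair) (simp add: algebra_simps)
    moreover have "lbracket M (f v) (f w) = g' t"
      by (simp only: v w fg t_def g'_def prod.case M.bracket_basis[OF cM] xyM xzM yzM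
          scaleR_Pair add_Pair) (simp add: algebra_simps)
    ultimately show ?thesis by (simp add: fg)
  qed
  ultimately show ?thesis
    unfolding lie_isomorphic_def by blast
qed

section \<open>Adapted bases\<close>

text \<open>With \<open>z\<close> in the role of i times \<open>y\<close>, \<open>ad x\<close> acts
  on the plane of \<open>y\<close> and \<open>z\<close> as multiplication by a + b i. Five real
  numbers thus replace the nine structure constants.\<close>

definition adapted_basis ::
  "'a::real_vector lie_struct \<Rightarrow> real \<Rightarrow> real \<Rightarrow> real \<Rightarrow> real \<Rightarrow> real \<Rightarrow> 'a \<Rightarrow> 'a \<Rightarrow> 'a \<Rightarrow> bool" where
  "adapted_basis L a b p q r x y z \<longleftrightarrow>
     lie_basis L x y z \<and>
     lbracket L x y = a *\<^sub>R y + b *\<^sub>R z \<and>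
     lbracket L x z = - b *\<^sub>R y + a *\<^sub>R z \<and>
     lbracket L y z = p *\<^sub>R x + q *\<^sub>R y + r *\<^sub>R z"

lemma lie_isomorphic_if_adapted_bases:
  assumes "real_lie_algebra L" "real_lie_algebra M"
    and "adapted_basis L a b p q r x y z" "adapted_basis M a b p q r x' y' z'"
  shows "lie_isomorphic L M"
  by (rule lie_isomorphic_if_same_constants[OF assms(1,2), of x y z x' y' z' 0 a b 0 "-b" a p q r])
    (use assms(3,4) in \<open>auto simp: adapted_basis_def\<close>)

section \<open>Identities for \<phi>, \<xi>, \<eta> and a basis built from the kernel of
  \<eta>\<close>

context almost_contact_lie_algebra
begin

lemma phi_carrier [simp]: "x \<in> lcarrier L \<Longrightarrow> \<phi> x \<in> lcarrier L"
  and phi_add: "x \<in> lcarrier L \<Longrightarrow> y \<in> lcarrier L \<Longrightarrow> \<phi> (x + y) = \<phi> x + \<phi> y"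
  and phi_scaleR: "x \<in> lcarrier L \<Longrightarrow> \<phi> (c *\<^sub>R x) = c *\<^sub>R \<phi> x"
  using phi_linear by (auto simp: linear_between_def)

lemma eta_add: "x \<in> lcarrier L \<Longrightarrow> y \<in> lcarrier L \<Longrightarrow> \<eta> (x + y) = \<eta> x + \<eta> y"
  and eta_scaleR: "x \<in> lcarrier L \<Longrightarrow> \<eta> (c *\<^sub>R x) = c * \<eta> x"
  using eta_linear by (auto simp: linear_between_def)

lemma xi_nonzero: "\<xi> \<noteq> 0"
  using eta_scaleR[OF xi_carrier, of 0] eta_xi by auto

lemma carrier_uminus: "x \<in> lcarrier L \<Longrightarrow> - x \<in> lcarrier L"
  using subspace_carrier by (rule subspace_neg)

lemma phi_uminus: "x \<in> lcarrier L \<Longrightarrow> \<phi> (- x) = - \<phi> x"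
  using phi_scaleR[of x "-1"] by simp

text \<open>Compare \<open>\<phi> (\<phi>\<^sup>2 x)\<close> with \<open>\<phi>\<^sup>2 (\<phi> x)\<close>.\<close>

lemma eta_phi_xi:
  assumes "x \<in> lcarrier L"
  shows "\<eta> x *\<^sub>R \<phi> \<xi> = \<eta> (\<phi> x) *\<^sub>R \<xi>"
proof -
  have "\<phi> (\<phi> (\<phi> x)) = - \<phi> x + \<eta> x *\<^sub>R \<phi> \<xi>"
    using assms phi_add[OF carrier_uminus carrier_scaleR[OF xi_carrier]]
    by (simp only: phi_phi phi_uminus phi_scaleR xi_carrier)
  moreover have "\<phi> (\<phi> (\<phi> x)) = - \<phi> x + \<eta> (\<phi> x) *\<^sub>R \<xi>"
    using assms by (simp add: phi_phi[of "\<phi> x"])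
  ultimately show ?thesis by simp
qed

text \<open>By \<open>eta_phi_xi\<close>, \<phi> \<xi> is a multiple c \<xi>. Since \<phi> squared
  kills \<xi>, c squared is zero.\<close>

lemma phi_xi: "\<phi> \<xi> = 0"
proof -
  have eq: "\<phi> \<xi> = \<eta> (\<phi> \<xi>) *\<^sub>R \<xi>"
    using eta_phi_xi[OF xi_carrier] by (simp add: eta_xi)
  have "\<phi> (\<phi> \<xi>) = 0"
    by (simp add: phi_phi xi_carrier eta_xi)
  then have "\<eta> (\<phi> \<xi>) *\<^sub>R \<phi> \<xi> = 0"
    using eq phi_scaleR[OF xi_carrier] by metis
  then show ?thesis
    using eq by auto
qed

lemma eta_phi: "x \<in> lcarrier L \<Longrightarrow> \<eta> (\<phi> x) = 0"
  using eta_phi_xi[of x] by (simp add: phi_xi xi_nonzero)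

lemma phi_phi_kernel: "x \<in> lcarrier L \<Longrightarrow> \<eta> x = 0 \<Longrightarrow> \<phi> (\<phi> x) = - x"
  by (simp add: phi_phi)

text \<open>Applying \<eta> isolates the coefficient of \<xi>. On the kernel of \<eta> the map
  \<phi> is a complex structure, so no nonzero \<open>e\<close> is linearly dependent with its
  image.\<close>

lemma phi_basis_independent:
  assumes e: "e \<in> lcarrier L" "\<eta> e = 0" "e \<noteq> 0"
    and 0: "a *\<^sub>R \<xi> + b *\<^sub>R e + c *\<^sub>R \<phi> e = 0"
  shows "a = 0 \<and> b = 0 \<and> c = 0"
proof -
  have "\<eta> (a *\<^sub>R \<xi> + b *\<^sub>R e + c *\<^sub>R \<phi> e) = a"
    using e by (simp add: eta_add eta_scaleR eta_phi eta_xi xi_carrier)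
  moreover have "\<eta> 0 = 0" "\<phi> 0 = 0"
    using eta_scaleR[OF e(1), of 0] phi_scaleR[OF e(1), of 0] by auto
  ultimately have a: "a = 0" using 0 by simp
  have "\<phi> (b *\<^sub>R e + c *\<^sub>R \<phi> e) = b *\<^sub>R \<phi> e - c *\<^sub>R e"
    using e by (simp add: phi_add phi_scaleR phi_phi_kernel)
  then have 1: "b *\<^sub>R \<phi> e = c *\<^sub>R e"
    using 0 a \<open>\<phi> 0 = 0\<close> by simp
  \<comment> \<open>This is (b - c \<phi>) (b + c \<phi>) e, expanded with \<phi> squared equal to
    -1 on the kernel.\<close>
  have "(b * b + c * c) *\<^sub>R e = b *\<^sub>R (b *\<^sub>R e + c *\<^sub>R \<phi> e) - c *\<^sub>R (b *\<^sub>R \<phi> e - c *\<^sub>R e)"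
    by (simp add: algebra_simps)
  also have "\<dots> = 0" using 0 a 1 by simp
  finally have "b * b + c * c = 0" using e by simp
  then show ?thesis using a by (simp add: sum_squares_eq_zero_iff)
qed

lemma phi_basis:
  assumes dim: "dim (lcarrier L) = 3"
    and e: "e \<in> lcarrier L" "\<eta> e = 0" "e \<noteq> 0"
  shows "lie_basis L \<xi> e (\<phi> e)"
proof -
  note indep = phi_basis_independent[OF e]
  have ne: "\<xi> \<noteq> e" "\<xi> \<noteq> \<phi> e" "e \<noteq> \<phi> e"
    using indep[of 1 "-1" 0] indep[of 1 0 "-1"] indep[of 0 1 "-1"] by auto
  let ?B = "{\<xi>, e, \<phi> e}"
  have "independent ?B"
  proof
    assume "dependent ?B"
    then obtain u where u: "u \<xi> \<noteq> 0 \<or> u e \<noteq> 0 \<or> u (\<phi> e) \<noteq> 0"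
      and "(\<Sum>v\<in>?B. u v *\<^sub>R v) = 0"
      by (auto simp: dependent_finite)
    then have "u \<xi> *\<^sub>R \<xi> + u e *\<^sub>R e + u (\<phi> e) *\<^sub>R \<phi> e = 0"
      using ne by (simp add: add.assoc)
    then show False using indep u by blast
  qed
  then have B: "independent ?B" "finite ?B" "card ?B = 3" "?B \<subseteq> lcarrier L"
    using ne e xi_carrier by auto
  have span: "v \<in> span ?B" if v: "v \<in> lcarrier L" for v
  proof (rule ccontr)
    assume nv: "v \<notin> span ?B"
    then have "independent (insert v ?B)" using B(1) by (rule independent_insertI)
    moreover obtain C where C: "C \<subseteq> lcarrier L" "independent C" "lcarrier L \<subseteq> span C"
      "card C = 3"
      using basis_exists dim by metis
    moreover have "finite C" using C(4) by (simp add: card_ge_0_finite)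
    ultimately have "card (insert v ?B) \<le> 3"
      using independent_span_bound[of C "insert v ?B"] B(4) v by auto
    moreover have "v \<notin> ?B" using nv span_base[of v ?B] by argo
    ultimately show False using B(2,3) by simp
  qed
  have "\<exists>a b c. v = a *\<^sub>R \<xi> + b *\<^sub>R e + c *\<^sub>R \<phi> e" if v: "v \<in> lcarrier L" for v
  proof -
    \<comment> \<open>\<open>span_breakdown_eq\<close> peels off one generator at a time until only
      the span of the empty set is left.\<close>
    from span[OF v] obtain a b c where "v - a *\<^sub>R \<xi> - b *\<^sub>R e - c *\<^sub>R \<phi> e = 0"
      unfolding span_breakdown_eq span_empty by blast
    then have "v = a *\<^sub>R \<xi> + b *\<^sub>R e + c *\<^sub>R \<phi> e" by (simp add: algebra_simps)
    then show ?thesis by blast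
  qed
  then show ?thesis
    using e xi_carrier indep by (auto simp: lie_basis_def)
qed

text \<open>For dimension reasons some vector lies off the line of \<xi>; its projection along \<xi>
  into the kernel of \<eta> is then nonzero.\<close>

lemma kernel_nontrivial:
  assumes "dim (lcarrier L) = 3"
  obtains e where "e \<in> lcarrier L" "\<eta> e = 0" "e \<noteq> 0"
proof -
  have "\<not> lcarrier L \<subseteq> span {\<xi>}"
  proof
    assume "lcarrier L \<subseteq> span {\<xi>}"
    then have "dim (lcarrier L) \<le> card {\<xi>}" by (rule dim_le_card) simp
    then show False using assms by simp
  qed
  then obtain v where v: "v \<in> lcarrier L" "v \<notin> span {\<xi>}" by blast
  show thesis
  proof
    show "v + (- \<eta> v) *\<^sub>R \<xi> \<in> lcarrier L"
      using v(1) xi_carrier carrier_add carrier_scaleR by blast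
    show "\<eta> (v + (- \<eta> v) *\<^sub>R \<xi>) = 0"
      using v(1) xi_carrier
      by (simp only: eta_add eta_scaleR eta_xi carrier_scaleR)
    show "v + (- \<eta> v) *\<^sub>R \<xi> \<noteq> 0"
      using v(2) by (auto simp: span_singleton)
  qed
qed

end

section \<open>Structure constants and the Jacobi identity\<close>

context abelian_almost_contact_lie_algebra
begin

text \<open>The basis is \<xi>, \<open>e\<close>, \<phi> e with \<open>e\<close> in the kernel of
  \<eta>. Commutation with \<phi> gives the complex form of \<open>ad \<xi>\<close>, and the Jacobi
  identity for the three basis vectors gives the equations.\<close>

lemma adapted_basis_exists:
  assumes dim: "dim (lcarrier L) = 3"
  obtains a b p q r x y z where "adapted_basis L a b p q r x y z"
    "a * p = 0" "a * q + b * r = 0" "b * q = a * r"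
proof -
  obtain e where e: "e \<in> lcarrier L" "\<eta> e = 0" "e \<noteq> 0"
    using kernel_nontrivial[OF dim] .
  define f where "f = \<phi> e"
  have f: "f \<in> lcarrier L" "\<phi> f = - e"
    using e by (simp_all add: f_def phi_phi_kernel)
  have bas: "lie_basis L \<xi> e f"
    unfolding f_def by (rule phi_basis[OF dim e])
  obtain k a b where xe: "lbracket L \<xi> e = k *\<^sub>R \<xi> + a *\<^sub>R e + b *\<^sub>R f"
    using bas bracket_carrier[OF xi_carrier e(1)] unfolding lie_basis_def by blast
  obtain p q r where ef: "lbracket L e f = p *\<^sub>R \<xi> + q *\<^sub>R e + r *\<^sub>R f"
    using bas bracket_carrier[OF e(1) f(1)] unfolding lie_basis_def by blast
  \<comment> \<open>Applying \<phi> to \<open>[\<xi>, e]\<close> drops its \<xi> component.\<close>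
  have xf: "lbracket L \<xi> f = - b *\<^sub>R e + a *\<^sub>R f"
    using ad_xi_phi[OF e(1)] xe e f xi_carrier
    by (simp add: f_def[symmetric] phi_add phi_scaleR phi_xi)
  \<comment> \<open>A second application of \<phi> leads back to \<open>- [\<xi>, e]\<close>, now
    without a \<xi> component, so the unknown \<open>k\<close> disappears.\<close>
  have "lbracket L \<xi> (\<phi> f) = \<phi> (- b *\<^sub>R e + a *\<^sub>R f)"
    using ad_xi_phi[OF f(1)] xf by simp
  moreover have "\<phi> (- b *\<^sub>R e + a *\<^sub>R f) = - b *\<^sub>R f - a *\<^sub>R e"
    using e f(1) phi_add[of "- b *\<^sub>R e" "a *\<^sub>R f"]
      phi_scaleR[OF e(1), of "-b"] phi_scaleR[OF f(1), of a] carrier_scaleR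
    by (metis f(2) f_def scaleR_minus_right uminus_add_conv_diff add.commute)
  moreover have "lbracket L \<xi> (\<phi> f) = - lbracket L \<xi> e"
    using bracket_scaleR_right[OF xi_carrier e(1), of "-1"] by (simp add: f(2))
  ultimately have xe': "lbracket L \<xi> e = a *\<^sub>R e + b *\<^sub>R f"
    by (metis minus_add_distrib minus_minus diff_conv_add_uminus scaleR_minus_left add.commute)
  have bas': "adapted_basis L a b p q r \<xi> e f"
    using bas xe' xf ef by (simp add: adapted_basis_def)
  have fx: "lbracket L f \<xi> = b *\<^sub>R e + (- a) *\<^sub>R f"
    using bracket_swap[OF xi_carrier f(1)] xf by simp
  have fe: "lbracket L f e = - (p *\<^sub>R \<xi> + q *\<^sub>R e + r *\<^sub>R f)"
    using bracket_swap[OF e(1) f(1)] ef by simp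
  have "lbracket L \<xi> (lbracket L e f) + lbracket L e (lbracket L f \<xi>)
      + lbracket L f (lbracket L \<xi> e) = 0"
    using jacobi xi_carrier e(1) f(1) by blast
  moreover have "lbracket L \<xi> (lbracket L e f) = q *\<^sub>R (a *\<^sub>R e + b *\<^sub>R f) + r *\<^sub>R (- b *\<^sub>R e + a *\<^sub>R f)"
    unfolding ef using xi_carrier e(1) f(1) by (simp add: alternating xe' xf)
  moreover have "lbracket L e (lbracket L f \<xi>) = (- a) *\<^sub>R (p *\<^sub>R \<xi> + q *\<^sub>R e + r *\<^sub>R f)"
    unfolding fx using e(1) f(1) by (simp only: bracket_add_right bracket_scaleR_right
        carrier_scaleR alternating ef) (simp add: algebra_simps)
  moreover have "lbracket L f (lbracket L \<xi> e) = (- a) *\<^sub>R (p *\<^sub>R \<xi> + q *\<^sub>R e + r *\<^sub>R f)"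
    unfolding xe' using e(1) f(1) by (simp add: alternating fe algebra_simps)
  ultimately have "q *\<^sub>R (a *\<^sub>R e + b *\<^sub>R f) + r *\<^sub>R (- b *\<^sub>R e + a *\<^sub>R f)
      + (- a) *\<^sub>R (p *\<^sub>R \<xi> + q *\<^sub>R e + r *\<^sub>R f) + (- a) *\<^sub>R (p *\<^sub>R \<xi> + q *\<^sub>R e + r *\<^sub>R f) = 0"
    by (simp only:)
  \<comment> \<open>Coefficients are collected along \<xi>, \<open>e\<close> and \<open>f\<close>.
    The \<xi> part first appears as two equal summands, one from each of the last two Jacobi
    terms.\<close>
  then have "(- (a * p)) *\<^sub>R \<xi> + (- (a * p)) *\<^sub>R \<xi> + (- (a * q + b * r)) *\<^sub>R e + (b * q - a * r) *\<^sub>R f = 0"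
    by (simp add: algebra_simps)
  then have "(- (a * p) + - (a * p)) *\<^sub>R \<xi> + (- (a * q + b * r)) *\<^sub>R e + (b * q - a * r) *\<^sub>R f = 0"
    by (simp only: scaleR_add_left)
  then have "- (a * p) + - (a * p) = 0 \<and> - (a * q + b * r) = 0 \<and> b * q - a * r = 0"
    using bas unfolding lie_basis_def by blast
  then show thesis
    using that[OF bas'] by simp
qed

end

section \<open>Adapted bases of the models\<close>

text \<open>Explicit coordinate functions \<open>A\<close>, \<open>B\<close>, \<open>C\<close> turn
  spanning into an identity that can be checked by calculation in each model.\<close>

lemma adapted_basisI:
  assumes "x \<in> lcarrier L" "y \<in> lcarrier L" "z \<in> lcarrier L"
    and "\<And>v. v \<in> lcarrier L \<Longrightarrow> v = A v *\<^sub>R x + B v *\<^sub>R y + C v *\<^sub>R z"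
    and "\<And>a b c. a *\<^sub>R x + b *\<^sub>R y + c *\<^sub>R z = 0 \<Longrightarrow> a = 0 \<and> b = 0 \<and> c = 0"
    and "lbracket L x y = a *\<^sub>R y + b *\<^sub>R z"
    and "lbracket L x z = - b *\<^sub>R y + a *\<^sub>R z"
    and "lbracket L y z = p *\<^sub>R x + q *\<^sub>R y + r *\<^sub>R z"
  shows "adapted_basis L a b p q r x y z"
  unfolding adapted_basis_def lie_basis_def
proof (intro conjI ballI)
  show "\<exists>a b c. v = a *\<^sub>R x + b *\<^sub>R y + c *\<^sub>R z" if "v \<in> lcarrier L" for v
    using assms(4)[OF that] by blast
qed (use assms(1-3,5-8) in simp_all)

lemma adapted_basis_abelian:
  "adapted_basis (abelian_lie :: (real^3) lie_struct) 0 0 0 0 0 (axis 1 1) (axis 2 1) (axis 3 1)"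
  by (rule adapted_basisI[where A = "\<lambda>v. v$1" and B = "\<lambda>v. v$2" and C = "\<lambda>v. v$3"])
    (simp_all add: abelian_lie_def vec_eq_iff forall_3 axis_def)

text \<open>The central vector is divided by \<open>p\<close>, so that \<open>p\<close> times it is
  the bracket of the other two.\<close>

lemma adapted_basis_heisenberg:
  assumes "p \<noteq> 0"
  shows "adapted_basis heisenberg_lie 0 0 p 0 0 (axis 3 (1 / p)) (axis 1 1) (axis 2 1)"
  by (rule adapted_basisI[where A = "\<lambda>v. p * v$3" and B = "\<lambda>v. v$1" and C = "\<lambda>v. v$2"])
    (use assms in \<open>simp_all add: heisenberg_lie_def lie3_def vec_eq_iff forall_3 axis_def\<close>)

text \<open>The first vector spans the central factor. The other two are chosen so that p x + q y +
  r z is the generator \<open>axis 2 1\<close> of the derived algebra; their \<open>aff_lie\<close>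
  parts have determinant q t + r n = 1, so their bracket is that generator too.\<close>

lemma adapted_basis_aff_times_real:
  fixes p :: real
  assumes "q * t + r * n = 1"
  shows "adapted_basis (lie_product aff_lie (abelian_lie :: real lie_struct)) 0 0 p q r
    (0, 1) (axis 1 r + axis 2 t, - p * t) (axis 1 (- q) + axis 2 n, - p * n)"
  by (rule adapted_basisI[where A = "\<lambda>v. snd v + p * fst v$2" and
        B = "\<lambda>v. n * fst v$1 + q * fst v$2" and C = "\<lambda>v. r * fst v$2 - t * fst v$1"])
    (use assms in \<open>auto simp: lie_product_def aff_lie_def abelian_lie_def prod_eq_iff vec_eq_iff
      forall_2 axis_def\<close>, algebra+)

lemma adapted_basis_r31:
  assumes "a \<noteq> 0"
  shows "adapted_basis r31_lie a 0 0 0 0 (axis 1 a) (axis 2 1) (axis 3 1)"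
  by (rule adapted_basisI[where A = "\<lambda>v. v$1 / a" and B = "\<lambda>v. v$2" and C = "\<lambda>v. v$3"])
    (use assms in \<open>simp_all add: r31_lie_def lie3_def vec_eq_iff forall_3 axis_def\<close>)

text \<open>In the complex coordinate with \<open>axis 3 1\<close> equal to i times
  \<open>axis 2 1\<close>, \<open>ad (axis 1 1)\<close> is multiplication by l - i. Scaling by -b
  makes this a + b i exactly when l = - a / b.\<close>

lemma adapted_basis_r3':
  assumes "b \<noteq> 0"
  shows "adapted_basis (r3'_lie (- a / b)) a b 0 0 0 (axis 1 (- b)) (axis 2 1) (axis 3 1)"
  by (rule adapted_basisI[where A = "\<lambda>v. - v$1 / b" and B = "\<lambda>v. v$2" and C = "\<lambda>v. v$3"])
    (use assms in \<open>simp_all add: r3'_lie_def lie3_def vec_eq_iff forall_3 axis_def\<close>)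

text \<open>Reversing the third vector conjugates l - i to l + i, and scaling by \<open>b\<close>
  gives a + b i for l = a / b. Together with the unreflected basis this allows either sign of the
  parameter.\<close>

lemma adapted_basis_r3'_reflected:
  assumes "b \<noteq> 0"
  shows "adapted_basis (r3'_lie (a / b)) a b 0 0 0 (axis 1 b) (axis 2 1) (axis 3 (- 1))"
  by (rule adapted_basisI[where A = "\<lambda>v. v$1 / b" and B = "\<lambda>v. v$2" and C = "\<lambda>v. - v$3"])
    (use assms in \<open>simp_all add: r3'_lie_def lie3_def vec_eq_iff forall_3 axis_def\<close>)

text \<open>The matrices are multiples by \<open>b\<close>, \<open>s\<close>, \<open>s\<close> of
  the cross products with the standard unit vectors, which satisfy the cyclic relations [E1,E2] =
  E3.\<close>

lemma adapted_basis_so3: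
  assumes "b \<noteq> 0" "s \<noteq> 0"
  shows "adapted_basis so3_lie 0 b (s\<^sup>2 / b) 0 0
    (vector [vector [0, 0, 0], vector [0, 0, - b], vector [0, b, 0]])
    (vector [vector [0, 0, s], vector [0, 0, 0], vector [- s, 0, 0]])
    (vector [vector [0, - s, 0], vector [s, 0, 0], vector [0, 0, 0]])"
proof (rule adapted_basisI[where A = "\<lambda>v. v$3$2 / b" and B = "\<lambda>v. v$1$3 / s"
      and C = "\<lambda>v. v$2$1 / s"], goal_cases)
  case (4 v)
  have v: "v$j$i = - v$i$j" for i j
  proof -
    have "v$j$i = transpose v $ i $ j" by (simp add: transpose_def)
    also have "\<dots> = (- v) $ i $ j" using 4 by (simp add: so3_lie_def)
    finally show ?thesis by (simp only: vector_uminus_component)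
  qed
  have "v$1$1 = 0" "v$2$2 = 0" "v$3$3 = 0" "v$1$2 = - v$2$1" "v$2$3 = - v$3$2" "v$3$1 = - v$1$3"
    using v[of 1 1] v[of 2 2] v[of 3 3] v[of 1 2] v[of 2 3] v[of 3 1] by linarith+
  then show ?case
    using assms by (simp add: vec_eq_iff forall_3)
qed (use assms in \<open>simp_all add: so3_lie_def matrix_commutator_def matrix_matrix_mult_def
  transpose_def sum_3 vec_eq_iff forall_3 power2_eq_square\<close>)

text \<open>The first matrix generates rotations and the other two span the symmetric traceless
  matrices. The bracket of two symmetric matrices gives the opposite sign of \<open>p\<close> from
  the case of \<open>so3_lie\<close>.\<close>

lemma adapted_basis_sl2:
  assumes "b \<noteq> 0" "s \<noteq> 0"
  shows "adapted_basis sl2_lie 0 b (- s\<^sup>2 / b) 0 0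
    (vector [vector [0, - b / 2], vector [b / 2, 0]])
    (vector [vector [s / 2, 0], vector [0, - s / 2]])
    (vector [vector [0, s / 2], vector [s / 2, 0]])"
  by (rule adapted_basisI[where A = "\<lambda>v. (v$2$1 - v$1$2) / b" and B = "\<lambda>v. 2 * v$1$1 / s"
        and C = "\<lambda>v. (v$1$2 + v$2$1) / s"])
    (use assms in \<open>auto simp: sl2_lie_def matrix_commutator_def matrix_matrix_mult_def trace_def
      sum_2 vec_eq_iff forall_2 power2_eq_square field_simps\<close>, algebra)

section \<open>Case distinction on the structure constants\<close>

theorem proposition3p17:
  fixes L :: "'a::real_vector lie_struct"
    and \<phi> :: "'a \<Rightarrow> 'a" and \<xi> :: 'a and \<eta> :: "'a \<Rightarrow> real"
  assumes "abelian_almost_contact_lie_algebra L \<phi> \<xi> \<eta>"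
    and "dim (lcarrier L) = 3"
  shows "lie_isomorphic L (abelian_lie :: (real^3) lie_struct)
       \<or> lie_isomorphic L heisenberg_lie
       \<or> lie_isomorphic L (lie_product aff_lie (abelian_lie :: real lie_struct))
       \<or> lie_isomorphic L so3_lie
       \<or> lie_isomorphic L sl2_lie
       \<or> lie_isomorphic L r31_lie
       \<or> (\<exists>l::real. l \<ge> 0 \<and> lie_isomorphic L (r3'_lie l))"
proof -
  interpret abelian_almost_contact_lie_algebra L \<phi> \<xi> \<eta> by fact
  obtain a b p q r x y z where L: "adapted_basis L a b p q r x y z"
    and ap: "a * p = 0" and jac: "a * q + b * r = 0" "b * q = a * r"
    using adapted_basis_exists[OF assms(2)] .
  note iso = lie_isomorphic_if_adapted_bases[OF real_lie_algebra_axioms]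
  show ?thesis
  proof (cases "a = 0 \<and> b = 0")
    case True
    \<comment> \<open>Now \<open>x\<close> is central and the derived algebra is spanned by
      \<open>[y, z]\<close>. Whether this vector is zero, a nonzero multiple of \<open>x\<close> or
      off the line of \<open>x\<close> separates the three models.\<close>
    show ?thesis
    proof (cases "q = 0 \<and> r = 0")
      case qr: True
      show ?thesis
      proof (cases "p = 0")
        case True
        then have "lie_isomorphic L (abelian_lie :: (real^3) lie_struct)"
          using L qr \<open>a = 0 \<and> b = 0\<close> adapted_basis_abelian
          by (auto intro: iso real_lie_algebra_abelian)
        then show ?thesis by blast
      next
        case False
        then have "lie_isomorphic L heisenberg_lie"
          using L qr \<open>a = 0 \<and> b = 0\<close> adapted_basis_heisenberg[OF False]
          by (auto intro: iso real_lie_algebra_heisenberg)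
        then show ?thesis by blast
      qed
    next
      case False
      then have "q * (1 / q) + r * 0 = 1 \<or> q * 0 + r * (1 / r) = 1"
        by auto
      then obtain t n where tn: "q * t + r * n = 1" by blast
      have "lie_isomorphic L (lie_product aff_lie (abelian_lie :: real lie_struct))"
        using L True adapted_basis_aff_times_real[OF tn]
        by (auto intro: iso real_lie_algebra_product real_lie_algebra_aff real_lie_algebra_abelian)
      then show ?thesis by blast
    qed
  next
    case False
    \<comment> \<open>Multiplying the complex Jacobi equation by the conjugate a + b i produces the
      squared norm.\<close>
    have "(a * a + b * b) * q = 0" "(a * a + b * b) * r = 0"
      using jac by algebra+
    then have qr: "q = 0" "r = 0"
      using False by (auto simp: sum_squares_eq_zero_iff)
    \<comment> \<open>A nonzero \<open>a\<close> forces \<open>p\<close> to vanish. The second case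
      also admits a = 0, which gives the parameter l = 0.\<close>
    consider "b = 0" "a \<noteq> 0" "p = 0" | "b \<noteq> 0" "p = 0" | "a = 0" "b * p > 0" | "a = 0" "b * p < 0"
      using False ap linorder_less_linear[of "b * p" 0] by auto
    then show ?thesis
    proof cases
      case 1
      then have "lie_isomorphic L r31_lie"
        using L qr adapted_basis_r31[of a] by (auto intro: iso real_lie_algebra_r31)
      then show ?thesis by blast
    next
      case 2
      show ?thesis
      proof (cases "a / b \<ge> 0")
        case True
        have "lie_isomorphic L (r3'_lie (a / b))"
          using L qr 2 adapted_basis_r3'_reflected[of b a]
          by (auto intro: iso real_lie_algebra_r3')
        then show ?thesis using True by blast
      next
        case False
        have "lie_isomorphic L (r3'_lie (- a / b))"
          using L qr 2 adapted_basis_r3'[of b a] by (auto intro: iso real_lie_algebra_r3')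
        moreover have "- a / b \<ge> 0" using False by simp
        ultimately show ?thesis by blast
      qed
    next
      case 3
      \<comment> \<open>The scale is chosen so that \<open>s\<^sup>2 / b\<close> equals
        \<open>p\<close>; the sign of b p decides between \<open>so3_lie\<close> and
        \<open>sl2_lie\<close>.\<close>
      define s where "s = sqrt (b * p)"
      have "b \<noteq> 0" "s \<noteq> 0" "p = s\<^sup>2 / b"
        using 3 by (auto simp: s_def)
      then have "lie_isomorphic L so3_lie"
        using L qr 3 adapted_basis_so3[of b s] by (auto intro: iso real_lie_algebra_so3)
      then show ?thesis by blast
    next
      case 4
      define s where "s = sqrt (- (b * p))"
      have "b \<noteq> 0" "s \<noteq> 0" "p = - s\<^sup>2 / b"
        using 4 by (auto simp: s_def)
      then have "lie_isomorphic L sl2_lie"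
        using L qr 4 adapted_basis_sl2[of b s] by (auto intro: iso real_lie_algebra_sl2)
      then show ?thesis by blast
    qed
  qed
qed

end
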